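(* Let $\mathcal{T}$ be a finite rooted tree with local routing weights at time $t$: every internal node $v$ with children $1,\ldots,b_v$ carries weights $w_{v,1}(t),\ldots,w_{v,b_v}(t)\ge 0$ on the edges to its children, with $\sum_{i=1}^{b_v} w_{v,i}(t)=1$. For each node $u$ let $a_u(t)=\prod_{e\in P(u)} w_e(t)$ be its node mass, where $P(u)$ is the sequence of edges on the path from the root to $u$. Then for every resolution cut $C$ of $\mathcal{T}$, $$\sum_{u\in C} a_u(t)=1.$$
   Context: Setting: $\mathcal{T}$ is a finite rooted tree, whose leaves are called components. At a given time $t$, each internal (selector) node $v$ with children $1,\ldots,b_v$ stores a local weight vector $(w_{v,1}(t),\ldots,w_{v,b_v}(t))$ with nonnegative real entries summing to $1$; the entry $w_{v,i}(t)$ is regarded as the weight $w_e(t)$ of the edge $e$ from $v$ to its $i$-th child. An internal node with exactly one child contains no decision, and its single outgoing edge has weight $1$. No assumption is made on how the weights arise or depend on $t$. Node mass: for any node $u$ (leaf or internal), $a_u(t)=\prod_{e\in P(u)} w_e(t)$, where $P(u)$ is the sequence of edges from the root to $u$; in particular $a_{\mathrm{root}}(t)=1$ (empty product). Resolution cut: a set $C$ of nodes of $\mathcal{T}$ that intersects every root-to-leaf path in exactly one node. *)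

theory Defs
  imports Complex_Main "Graph_Theory.Arc_Walk"
begin

text \<open>
  A finite rooted tree is represented as a finite digraph whose arcs point from parents to
  children. Uniqueness ranges over all walks from the root, which excludes
  parallel arcs, cycles, and arcs into the root. The predicate \<open>tree\<close> of
  \<open>Graph_Theory.Digraph_Component\<close> is not suitable: its acyclicity refers to directed
  cycles only, so it also holds of any weakly connected acyclic digraph.
\<close>

locale rooted_tree = fin_digraph T
  for T :: "('a, 'b) pre_digraph" (structure) +
  fixes r :: 'a
  assumes root_in_verts: "r \<in> verts T"
    and unique_awalk_from_root: "v \<in> verts T \<Longrightarrow> \<exists>!p. awalk r p v"
begin

definition leaf :: "'a \<Rightarrow> bool" where
  "leaf v \<longleftrightarrow> v \<in> verts T \<and> out_arcs T v = {}"

definition internal :: "'a \<Rightarrow> bool" where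
  "internal v \<longleftrightarrow> v \<in> verts T \<and> out_arcs T v \<noteq> {}"

text \<open>
  Weights are indexed by arcs: an arc out of \<open>v\<close> identifies a child of \<open>v\<close>. Values
  outside \<open>arcs T\<close> are irrelevant.
\<close>

definition routing_weights :: "('b \<Rightarrow> real) \<Rightarrow> bool" where
  "routing_weights w \<longleftrightarrow>
    (\<forall>v. internal v \<longrightarrow> (\<forall>e\<in>out_arcs T v. 0 \<le> w e) \<and> (\<Sum>e\<in>out_arcs T v. w e) = 1)"

definition root_path :: "'a \<Rightarrow> 'b awalk" where
  "root_path u = (THE p. awalk r p u)"

definition node_mass :: "('b \<Rightarrow> real) \<Rightarrow> 'a \<Rightarrow> real" where
  "node_mass w u = prod_list (map w (root_path u))"

definition resolution_cut :: "'a set \<Rightarrow> bool" where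
  "resolution_cut C \<longleftrightarrow> C \<subseteq> verts T \<and>
    (\<forall>l. leaf l \<longrightarrow> (\<exists>!u. u \<in> C \<and> u \<in> set (awalk_verts r (root_path l))))"

lemma awalk_root_path:
  assumes "u \<in> verts T"
  shows "awalk r (root_path u) u"
  unfolding root_path_def by (rule theI'[OF unique_awalk_from_root[OF assms]])

lemma root_path_eqI:
  assumes "awalk r p u"
  shows "root_path u = p"
  using assms awalk_root_path unique_awalk_from_root awalk_last_in_verts by blast

lemma node_mass_root: "node_mass w r = 1"
proof -
  have "awalk r [] r" using root_in_verts by (simp add: awalk_Nil_iff)
  then show ?thesis by (simp add: node_mass_def root_path_eqI)
qed

lemma routing_weight_only_child:
  assumes "routing_weights w" "v \<in> verts T" "out_arcs T v = {e}"
  shows "w e = 1"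
  using assms by (force simp: routing_weights_def internal_def)

end

end

theory Submission
  imports Defs
begin

text \<open>
  By induction from the leaves upwards, the mass of a node is the total mass of the leaves
  below it. A resolution cut partitions the leaves according to the cut node above them, so
  its total mass is that of all leaves, which is the mass of the root.
\<close>

context rooted_tree
begin

text \<open>Reachability, rather than membership in a root path, makes these sets easy to split
  along the first arc of a walk.\<close>

definition leaves_below :: "'a \<Rightarrow> 'a set" where
  "leaves_below v = {l. leaf l \<and> v \<rightarrow>\<^sup>* l}"

lemma finite_leaves_below: "finite (leaves_below v)"
  by (rule finite_subset[OF _ finite_verts]) (auto simp: leaves_below_def leaf_def)

text \<open>Following the root path of \<open>v\<close> by \<open>q\<close> gives a walk from
  \<open>r\<close> to \<open>l\<close>, and there is only one.\<close>

lemma root_path_append: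
  assumes "v \<in> verts T" "awalk v q l"
  shows "root_path l = root_path v @ q"
  using root_path_eqI[OF awalk_appendI[OF awalk_root_path[OF assms(1)] assms(2)]] .

lemma root_path_head:
  assumes "e \<in> out_arcs T v"
  shows "root_path (head T e) = root_path v @ [e]"
  using assms by (intro root_path_append) (auto simp: awalk_simps)

lemma node_mass_head:
  assumes "e \<in> out_arcs T v"
  shows "node_mass w (head T e) = node_mass w v * w e"
  by (simp add: node_mass_def root_path_head[OF assms])

text \<open>Links \<open>leaves_below\<close> to the definition of a resolution cut. A walk from
  \<open>v\<close> to \<open>l\<close> extends the root path of \<open>v\<close> to that of
  \<open>l\<close>; conversely, the root path of \<open>l\<close> can be cut at
  \<open>v\<close>.\<close>

lemma reachable_iff_mem_root_path:
  assumes "l \<in> verts T"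
  shows "v \<rightarrow>\<^sup>* l \<longleftrightarrow> v \<in> set (awalk_verts r (root_path l))"
proof
  assume "v \<rightarrow>\<^sup>* l"
  then obtain q where q: "awalk v q l" by (auto simp: reachable_awalk)
  then have v: "v \<in> verts T" by auto
  show "v \<in> set (awalk_verts r (root_path l))"
    using root_path_append[OF v q] set_awalk_verts_append[OF awalk_root_path[OF v] q]
      hd_in_awalk_verts(1)[OF q] by simp
next
  assume "v \<in> set (awalk_verts r (root_path l))"
  then obtain q where "awalk v q l"
    using awalk_decomp[OF awalk_root_path[OF assms]] by blast
  then show "v \<rightarrow>\<^sup>* l" by (auto simp: reachable_awalk)
qed

text \<open>Bounds the depth, so that induction from the leaves upwards is well-founded.\<close>

lemma length_root_path_less:
  assumes "v \<in> verts T"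
  shows "length (root_path v) < card (verts T)"
proof -
  have "apath r (awalk_to_apath (root_path v)) v"
    using awalk_root_path[OF assms] by (rule apath_awalk_to_apath)
  \<comment> \<open>Removing cycles from the root path leaves a walk from \<open>r\<close> to
    \<open>v\<close>; by uniqueness it is the root path itself.\<close>
  then have "apath r (root_path v) v"
    using root_path_eqI awalkI_apath by metis
  then show ?thesis by (rule length_apath_less)
qed

lemma leaves_below_leaf:
  assumes "leaf v"
  shows "leaves_below v = {v}"
proof -
  have "l = v" if "awalk v q l" for q l
    using that assms by (cases q) (auto simp: leaf_def awalk_simps)
  then show ?thesis
    using assms by (auto simp: leaves_below_def leaf_def reachable_awalk intro: awalk_Nil_iff[THEN iffD2])
qed

text \<open>A walk from an internal node to a leaf is nonempty, so it splits into a first arc and a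
  walk from a child.\<close>

lemma leaves_below_internal:
  assumes "internal v"
  shows "leaves_below v = (\<Union>e\<in>out_arcs T v. leaves_below (head T e))"
proof (intro equalityI subsetI)
  fix l assume "l \<in> leaves_below v"
  then obtain q where l: "leaf l" and q: "awalk v q l"
    by (auto simp: leaves_below_def reachable_awalk)
  have "q \<noteq> []"
    using l q assms by (auto simp: leaf_def internal_def awalk_simps)
  then obtain e q' where "q = e # q'" by (cases q) auto
  then show "l \<in> (\<Union>e\<in>out_arcs T v. leaves_below (head T e))"
    using l q by (auto simp: leaves_below_def reachable_awalk awalk_Cons_iff)
next
  fix l assume "l \<in> (\<Union>e\<in>out_arcs T v. leaves_below (head T e))"
  then obtain e q where "e \<in> out_arcs T v" "leaf l" "awalk (head T e) q l"
    by (auto simp: leaves_below_def reachable_awalk)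
  then have "awalk v (e # q) l" by (auto simp: awalk_Cons_iff)
  then show "l \<in> leaves_below v"
    using \<open>leaf l\<close> by (auto simp: leaves_below_def reachable_awalk)
qed

text \<open>A common leaf would have two root paths, which differ in the arc right after
  \<open>root_path v\<close>.\<close>

lemma leaves_below_children_disjoint:
  assumes "e \<in> out_arcs T v" "e' \<in> out_arcs T v" "e \<noteq> e'"
  shows "leaves_below (head T e) \<inter> leaves_below (head T e') = {}"
proof (rule ccontr)
  assume "leaves_below (head T e) \<inter> leaves_below (head T e') \<noteq> {}"
  then obtain l q q' where "awalk (head T e) q l" "awalk (head T e') q' l"
    by (auto simp: leaves_below_def reachable_awalk)
  then have "root_path l = (root_path v @ [e]) @ q" "root_path l = (root_path v @ [e']) @ q'"
    using assms root_path_head root_path_append by (metis awalk_hd_in_verts)+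
  then show False using assms(3) by simp
qed

lemma node_mass_eq_sum_leaves_below:
  assumes w: "routing_weights w" and v: "v \<in> verts T"
  shows "node_mass w v = (\<Sum>l\<in>leaves_below v. node_mass w l)"
  using v
\<comment> \<open>A child is one arc deeper than its parent. As the depth stays below
  \<open>card (verts T)\<close>, the truncated difference strictly decreases from \<open>v\<close>
  to its children.\<close>
proof (induction "card (verts T) - length (root_path v)" arbitrary: v rule: less_induct)
  case less
  show ?case
  proof (cases "leaf v")
    case True
    then show ?thesis by (simp add: leaves_below_leaf)
  next
    case False
    then have v: "internal v" using less.prems by (simp add: leaf_def internal_def)
    have IH: "(\<Sum>l\<in>leaves_below (head T e). node_mass w l) = node_mass w v * w e"
      if e: "e \<in> out_arcs T v" for e
    proof -
      have h: "head T e \<in> verts T" using e by auto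
      have "node_mass w (head T e) = (\<Sum>l\<in>leaves_below (head T e). node_mass w l)"
        using length_root_path_less[OF less.prems] root_path_head[OF e]
        by (intro less.hyps h) auto
      then show ?thesis using node_mass_head[OF e] by simp
    qed
    have "(\<Sum>l\<in>leaves_below v. node_mass w l)
        = (\<Sum>e\<in>out_arcs T v. \<Sum>l\<in>leaves_below (head T e). node_mass w l)"
      unfolding leaves_below_internal[OF v]
      by (rule sum.UNION_disjoint)
        (auto simp: finite_leaves_below leaves_below_children_disjoint simp del: in_out_arcs_conv)
    also have "\<dots> = node_mass w v * (\<Sum>e\<in>out_arcs T v. w e)"
      by (simp add: IH sum_distrib_left)
    also have "\<dots> = node_mass w v"
      using w v by (simp add: routing_weights_def)
    finally show ?thesis by simp
  qed
qed

text \<open>The cut nodes on the root path of \<open>l\<close> are exactly those from which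
  \<open>l\<close> is reachable.\<close>

lemma resolution_cut_leaf:
  assumes "resolution_cut C" "leaf l"
  shows "\<exists>!u. u \<in> C \<and> l \<in> leaves_below u"
  using assms by (simp add: resolution_cut_def leaves_below_def leaf_def reachable_iff_mem_root_path)

lemma sum_node_mass_resolution_cut:
  assumes w: "routing_weights w" and C: "resolution_cut C"
  shows "(\<Sum>u\<in>C. node_mass w u) = 1"
proof -
  have sub: "C \<subseteq> verts T" using C by (simp add: resolution_cut_def)
  have root: "leaves_below r = {l. leaf l}"
    using awalk_root_path by (auto simp: leaves_below_def leaf_def reachable_awalk)
  \<comment> \<open>Existence of a cut node above each leaf gives the covering.\<close>
  have "(\<Union>u\<in>C. leaves_below u) = leaves_below r"
    unfolding root using resolution_cut_leaf[OF C] by (fastforce simp: leaves_below_def)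
  \<comment> \<open>Uniqueness of that cut node gives disjointness.\<close>
  moreover have "\<forall>u\<in>C. \<forall>u'\<in>C. u \<noteq> u' \<longrightarrow> leaves_below u \<inter> leaves_below u' = {}"
    using resolution_cut_leaf[OF C] by (fastforce simp: leaves_below_def)
  ultimately have "(\<Sum>u\<in>C. \<Sum>l\<in>leaves_below u. node_mass w l) = (\<Sum>l\<in>leaves_below r. node_mass w l)"
    using sum.UNION_disjoint[of C leaves_below "node_mass w"] finite_subset[OF sub finite_verts]
    by (simp add: finite_leaves_below)
  also have "\<dots> = 1"
    using node_mass_eq_sum_leaves_below[OF w root_in_verts] by (simp add: node_mass_root)
  also have "(\<Sum>u\<in>C. \<Sum>l\<in>leaves_below u. node_mass w l) = (\<Sum>u\<in>C. node_mass w u)"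
    using sub by (intro sum.cong refl node_mass_eq_sum_leaves_below[OF w, symmetric]) auto
  finally show ?thesis .
qed

end

text \<open>Time is a mere index of an arbitrary type: the claim at \<open>t\<close> is the static
  one for the weights \<open>w t\<close>.\<close>

theorem proposition1:
  fixes T :: "('a, 'b) pre_digraph" and r :: 'a
    and w :: "'t \<Rightarrow> 'b \<Rightarrow> real" and t :: 't
    and C :: "'a set"
  assumes "rooted_tree T r"
    and "rooted_tree.routing_weights T (w t)"
    and "rooted_tree.resolution_cut T r C"
  shows "(\<Sum>u\<in>C. rooted_tree.node_mass T r (w t) u) = 1"
  using assms by (rule rooted_tree.sum_node_mass_resolution_cut)

end
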